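(* There are inductive definition systems $(\Sigma_1,\Phi_1)$ and $(\Sigma_2,\Phi_2)$ with $\Sigma_1\subseteq\Sigma_2$ and $\Phi_1\subseteq\Phi_2$ (so that $\mathrm{LKID}(\Sigma_2,\Phi_2)$ is an extension of $\mathrm{LKID}(\Sigma_1,\Phi_1)$) such that $\mathrm{LKID}(\Sigma_2,\Phi_2)$ is not conservative over $\mathrm{LKID}(\Sigma_1,\Phi_1)$, i.e. there is a sequent in the language of $\Sigma_1$ that is provable in $\mathrm{LKID}(\Sigma_2,\Phi_2)$ but not in $\mathrm{LKID}(\Sigma_1,\Phi_1)$.
   Context: An inductive definition system $(\Sigma,\Phi)$ consists of a first-order signature $\Sigma$ with equality in which some predicate symbols $P_1,\dots,P_n$ are designated inductive, and a finite set $\Phi$ of productions, each of the form: from atomic premises $Q_1(\vec u_1),\dots,Q_h(\vec u_h),P_{j_1}(\vec t_1),\dots,P_{j_m}(\vec t_m)$ (the $Q$'s ordinary predicate symbols) infer $P_i(\vec t)$. $\mathrm{LKID}(\Sigma,\Phi)$ is the classical first-order sequent calculus with equality (axiom, weakening, cut, substitution, standard logical rules, equality rules $\Gamma\vdash t=t,\Delta$ and from $\Gamma[u/x,t/y]\vdash\Delta[u/x,t/y]$ infer $\Gamma[t/x,u/y],t=u\vdash\Delta[t/x,u/y]$), extended for each production by the right-introduction rule (from $\Gamma\vdash\Delta,Q_k(\vec u_k[\vec u])$ for all $k$ and $\Gamma\vdash\Delta,P_{j_l}(\vec t_l[\vec u])$ for all $l$, infer $\Gamma\vdash\Delta,P_i(\vec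 t[\vec u])$), and for each inductive predicate $P_j$ by Martin-Löf style induction rule: choose for each inductive $P_i$ an induction formula $F_i(\vec z_i)$; let $G_i=F_i$ if $P_i$ and $P_j$ are mutually dependent (each reachable from the other via the relation "$P_k$ occurs as a premise of a production with conclusion $P_l$") and $G_i=P_i(\vec z_i)$ otherwise; from the major premise $\Gamma,F_j\vec u\vdash\Delta$ and, for each production with conclusion $P_i$ mutually dependent with $P_j$, the minor premise $\Gamma,Q_1\vec u_1[\vec y],\dots,Q_h\vec u_h[\vec y],G_{j_1}\vec t_1[\vec y],\dots,G_{j_m}\vec t_m[\vec y]\vdash F_i\vec t[\vec y],\Delta$ ($\vec y$ fresh), infer $\Gamma,P_j\vec u\vdash\Delta$. *)

theory Defs
  imports Main
begin

text \<open>
  Terms and formulas use de Bruijn indices: an index that exceeds the number of enclosing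
  quantifiers denotes a free variable. All substitutions are simultaneous and capture-avoiding.
\<close>

datatype 'f tm = Var nat | Fun 'f "'f tm list"

datatype ('f, 'p) fm =
    Pred 'p "'f tm list"
  | Eq "'f tm" "'f tm"
  | Neg "('f, 'p) fm"
  | Conj "('f, 'p) fm" "('f, 'p) fm"
  | Disj "('f, 'p) fm" "('f, 'p) fm"
  | Imp "('f, 'p) fm" "('f, 'p) fm"
  | All "('f, 'p) fm"
  | Ex "('f, 'p) fm"

primrec subst_tm :: "(nat \<Rightarrow> 'f tm) \<Rightarrow> 'f tm \<Rightarrow> 'f tm" where
  "subst_tm \<theta> (Var n) = \<theta> n"
| "subst_tm \<theta> (Fun f ts) = Fun f (map (subst_tm \<theta>) ts)"

definition shift_tm :: "'f tm \<Rightarrow> 'f tm" where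
  "shift_tm = subst_tm (\<lambda>n. Var (Suc n))"

primrec subst :: "(nat \<Rightarrow> 'f tm) \<Rightarrow> ('f, 'p) fm \<Rightarrow> ('f, 'p) fm" where
  "subst \<theta> (Pred P ts) = Pred P (map (subst_tm \<theta>) ts)"
| "subst \<theta> (Eq t u) = Eq (subst_tm \<theta> t) (subst_tm \<theta> u)"
| "subst \<theta> (Neg F) = Neg (subst \<theta> F)"
| "subst \<theta> (Conj F G) = Conj (subst \<theta> F) (subst \<theta> G)"
| "subst \<theta> (Disj F G) = Disj (subst \<theta> F) (subst \<theta> G)"
| "subst \<theta> (Imp F G) = Imp (subst \<theta> F) (subst \<theta> G)"
| "subst \<theta> (All F) = All (subst (case_nat (Var 0) (\<lambda>n. shift_tm (\<theta> n))) F)"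
| "subst \<theta> (Ex F) = Ex (subst (case_nat (Var 0) (\<lambda>n. shift_tm (\<theta> n))) F)"

text \<open>Renames the free variables so that \<open>0, \<dots>, k - 1\<close> become fresh.\<close>
definition shift :: "nat \<Rightarrow> ('f, 'p) fm \<Rightarrow> ('f, 'p) fm" where
  "shift k = subst (\<lambda>n. Var (n + k))"

text \<open>Instance of the body \<open>F\<close> of a quantified formula.\<close>
definition inst :: "'f tm \<Rightarrow> ('f, 'p) fm \<Rightarrow> ('f, 'p) fm" where
  "inst t = subst (case_nat t Var)"

text \<open>
  An induction formula \<open>F\<close> for a predicate of arity \<open>a\<close> has \<open>0, \<dots>, a - 1\<close> as its argument
  variables, and \<open>a + n\<close> stands for the parameter \<open>n\<close> of the sequent in which \<open>F\<close> is used.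
  \<open>app k F ts\<close> is \<open>F\<close> applied to \<open>ts\<close> in a context where \<open>k\<close> fresh variables have been
  introduced.
\<close>
definition app :: "nat \<Rightarrow> ('f, 'p) fm \<Rightarrow> 'f tm list \<Rightarrow> ('f, 'p) fm" where
  "app k F ts = subst (\<lambda>n. if n < length ts then ts ! n else Var (n - length ts + k)) F"

record ('f, 'p) signature =
  fun_ar :: "'f \<rightharpoonup> nat"
  ord_ar :: "'p \<rightharpoonup> nat"  \<comment> \<open>ordinary predicate symbols\<close>
  ind_ar :: "'p \<rightharpoonup> nat"  \<comment> \<open>inductive predicate symbols\<close>

definition sig_le :: "('f, 'p) signature \<Rightarrow> ('f, 'p) signature \<Rightarrow> bool" (infix \<open>\<subseteq>\<^sub>S\<close> 50) where
  "\<Sigma>1 \<subseteq>\<^sub>S \<Sigma>2 \<longleftrightarrow>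
     fun_ar \<Sigma>1 \<subseteq>\<^sub>m fun_ar \<Sigma>2 \<and> ord_ar \<Sigma>1 \<subseteq>\<^sub>m ord_ar \<Sigma>2 \<and> ind_ar \<Sigma>1 \<subseteq>\<^sub>m ind_ar \<Sigma>2"

primrec wf_tm :: "('f, 'p) signature \<Rightarrow> 'f tm \<Rightarrow> bool" where
  "wf_tm \<Sigma> (Var n) \<longleftrightarrow> True"
| "wf_tm \<Sigma> (Fun f ts) \<longleftrightarrow> fun_ar \<Sigma> f = Some (length ts) \<and> list_all (wf_tm \<Sigma>) ts"

primrec wf_fm :: "('f, 'p) signature \<Rightarrow> ('f, 'p) fm \<Rightarrow> bool" where
  "wf_fm \<Sigma> (Pred P ts) \<longleftrightarrow>
     (ord_ar \<Sigma> P = Some (length ts) \<or> ind_ar \<Sigma> P = Some (length ts)) \<and> list_all (wf_tm \<Sigma>) ts"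
| "wf_fm \<Sigma> (Eq t u) \<longleftrightarrow> wf_tm \<Sigma> t \<and> wf_tm \<Sigma> u"
| "wf_fm \<Sigma> (Neg F) \<longleftrightarrow> wf_fm \<Sigma> F"
| "wf_fm \<Sigma> (Conj F G) \<longleftrightarrow> wf_fm \<Sigma> F \<and> wf_fm \<Sigma> G"
| "wf_fm \<Sigma> (Disj F G) \<longleftrightarrow> wf_fm \<Sigma> F \<and> wf_fm \<Sigma> G"
| "wf_fm \<Sigma> (Imp F G) \<longleftrightarrow> wf_fm \<Sigma> F \<and> wf_fm \<Sigma> G"
| "wf_fm \<Sigma> (All F) \<longleftrightarrow> wf_fm \<Sigma> F"
| "wf_fm \<Sigma> (Ex F) \<longleftrightarrow> wf_fm \<Sigma> F"

primrec vars_tm :: "'f tm \<Rightarrow> nat set" where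
  "vars_tm (Var n) = {n}"
| "vars_tm (Fun f ts) = \<Union> (set (map vars_tm ts))"

text \<open>A production in the variables \<open>0, \<dots>, nvars - 1\<close>.\<close>
record ('f, 'p) production =
  nvars :: nat
  ord_prems :: "('p \<times> 'f tm list) list"
  ind_prems :: "('p \<times> 'f tm list) list"
  concl_pred :: 'p
  concl_args :: "'f tm list"

definition wf_production :: "('f, 'p) signature \<Rightarrow> ('f, 'p) production \<Rightarrow> bool" where
  "wf_production \<Sigma> r \<longleftrightarrow>
     (\<forall>(Q, us) \<in> set (ord_prems r). ord_ar \<Sigma> Q = Some (length us)) \<and>
     (\<forall>(P, ts) \<in> set (ind_prems r). ind_ar \<Sigma> P = Some (length ts)) \<and>
     ind_ar \<Sigma> (concl_pred r) = Some (length (concl_args r)) \<and>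
     (\<forall>t \<in> set (concl_args r) \<union> (\<Union>(P, ts) \<in> set (ord_prems r @ ind_prems r). set ts).
        wf_tm \<Sigma> t \<and> vars_tm t \<subseteq> {..<nvars r})"

definition inductive_definition_system ::
    "('f, 'p) signature \<Rightarrow> ('f, 'p) production set \<Rightarrow> bool" where
  "inductive_definition_system \<Sigma> \<Phi> \<longleftrightarrow>
     dom (ord_ar \<Sigma>) \<inter> dom (ind_ar \<Sigma>) = {} \<and> finite (dom (ind_ar \<Sigma>)) \<and>
     finite \<Phi> \<and> (\<forall>r \<in> \<Phi>. wf_production \<Sigma> r)"

definition prem_rel :: "('f, 'p) production set \<Rightarrow> ('p \<times> 'p) set" where
  "prem_rel \<Phi> = {(P, concl_pred r) | P r. r \<in> \<Phi> \<and> P \<in> fst ` set (ind_prems r)}"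

definition mutually_dependent :: "('f, 'p) production set \<Rightarrow> 'p \<Rightarrow> 'p \<Rightarrow> bool" where
  "mutually_dependent \<Phi> P P' \<longleftrightarrow> (P, P') \<in> (prem_rel \<Phi>)\<^sup>* \<and> (P', P) \<in> (prem_rel \<Phi>)\<^sup>*"

text \<open>Both sides of a sequent are finite sets, so exchange and contraction are implicit.\<close>
datatype ('f, 'p) sequent = Sequent "('f, 'p) fm set" "('f, 'p) fm set" (infix \<open>\<turnstile>\<close> 45)

fun wf_sequent :: "('f, 'p) signature \<Rightarrow> ('f, 'p) sequent \<Rightarrow> bool" where
  "wf_sequent \<Sigma> (\<Gamma> \<turnstile> \<Delta>) \<longleftrightarrow> finite \<Gamma> \<and> finite \<Delta> \<and> (\<forall>F \<in> \<Gamma> \<union> \<Delta>. wf_fm \<Sigma> F)"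

text \<open>
  The formula replacing an inductive premise \<open>P ts\<close> of a production with \<open>k\<close> variables in a minor
  premise of the induction rule for \<open>P\<^sub>j\<close>.
\<close>
definition ind_hyp ::
    "('f, 'p) production set \<Rightarrow> ('p \<Rightarrow> ('f, 'p) fm) \<Rightarrow> 'p \<Rightarrow> nat \<Rightarrow> 'p \<Rightarrow> 'f tm list \<Rightarrow> ('f, 'p) fm" where
  "ind_hyp \<Phi> F Pj k P ts = (if mutually_dependent \<Phi> P Pj then app k (F P) ts else Pred P ts)"

text \<open>
  The variables of \<open>r\<close> are the fresh variables \<open>0, \<dots>, nvars r - 1\<close> of the minor premise; the side
  formulas and the parameters of the induction formulas are shifted past them.
\<close>
definition minor_premise ::
    "('f, 'p) production set \<Rightarrow> ('p \<Rightarrow> ('f, 'p) fm) \<Rightarrow> 'p \<Rightarrow>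
     ('f, 'p) fm set \<Rightarrow> ('f, 'p) fm set \<Rightarrow> ('f, 'p) production \<Rightarrow> ('f, 'p) sequent" where
  "minor_premise \<Phi> F Pj \<Gamma> \<Delta> r =
     (shift (nvars r) ` \<Gamma>
       \<union> (\<lambda>(Q, us). Pred Q us) ` set (ord_prems r)
       \<union> (\<lambda>(P, ts). ind_hyp \<Phi> F Pj (nvars r) P ts) ` set (ind_prems r)
      \<turnstile> insert (app (nvars r) (F (concl_pred r)) (concl_args r)) (shift (nvars r) ` \<Delta>))"

text \<open>
  \<open>lkid_rule \<Sigma> \<Phi> S s\<close>: the sequent \<open>s\<close> is the conclusion of a rule instance with premises \<open>S\<close>.
  That all formulas belong to the language of \<open>\<Sigma>\<close> is imposed in \<open>LKID\<close> below.
\<close>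
inductive lkid_rule ::
    "('f, 'p) signature \<Rightarrow> ('f, 'p) production set \<Rightarrow> ('f, 'p) sequent set \<Rightarrow> ('f, 'p) sequent \<Rightarrow> bool"
  for \<Sigma> \<Phi> where
  Axiom: "\<Gamma> \<inter> \<Delta> \<noteq> {} \<Longrightarrow> lkid_rule \<Sigma> \<Phi> {} (\<Gamma> \<turnstile> \<Delta>)"
| Wk: "\<Gamma>' \<subseteq> \<Gamma> \<Longrightarrow> \<Delta>' \<subseteq> \<Delta> \<Longrightarrow> lkid_rule \<Sigma> \<Phi> {\<Gamma>' \<turnstile> \<Delta>'} (\<Gamma> \<turnstile> \<Delta>)"
| Cut: "lkid_rule \<Sigma> \<Phi> {\<Gamma> \<turnstile> insert F \<Delta>, insert F \<Gamma> \<turnstile> \<Delta>} (\<Gamma> \<turnstile> \<Delta>)"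
| Subst: "lkid_rule \<Sigma> \<Phi> {\<Gamma> \<turnstile> \<Delta>} (subst \<theta> ` \<Gamma> \<turnstile> subst \<theta> ` \<Delta>)"
| NegL: "lkid_rule \<Sigma> \<Phi> {\<Gamma> \<turnstile> insert F \<Delta>} (insert (Neg F) \<Gamma> \<turnstile> \<Delta>)"
| NegR: "lkid_rule \<Sigma> \<Phi> {insert F \<Gamma> \<turnstile> \<Delta>} (\<Gamma> \<turnstile> insert (Neg F) \<Delta>)"
| ConjL: "lkid_rule \<Sigma> \<Phi> {insert F (insert G \<Gamma>) \<turnstile> \<Delta>} (insert (Conj F G) \<Gamma> \<turnstile> \<Delta>)"
| ConjR: "lkid_rule \<Sigma> \<Phi> {\<Gamma> \<turnstile> insert F \<Delta>, \<Gamma> \<turnstile> insert G \<Delta>} (\<Gamma> \<turnstile> insert (Conj F G) \<Delta>)"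
| DisjL: "lkid_rule \<Sigma> \<Phi> {insert F \<Gamma> \<turnstile> \<Delta>, insert G \<Gamma> \<turnstile> \<Delta>} (insert (Disj F G) \<Gamma> \<turnstile> \<Delta>)"
| DisjR: "lkid_rule \<Sigma> \<Phi> {\<Gamma> \<turnstile> insert F (insert G \<Delta>)} (\<Gamma> \<turnstile> insert (Disj F G) \<Delta>)"
| ImpL: "lkid_rule \<Sigma> \<Phi> {\<Gamma> \<turnstile> insert F \<Delta>, insert G \<Gamma> \<turnstile> \<Delta>} (insert (Imp F G) \<Gamma> \<turnstile> \<Delta>)"
| ImpR: "lkid_rule \<Sigma> \<Phi> {insert F \<Gamma> \<turnstile> insert G \<Delta>} (\<Gamma> \<turnstile> insert (Imp F G) \<Delta>)"
| AllL: "lkid_rule \<Sigma> \<Phi> {insert (inst t F) \<Gamma> \<turnstile> \<Delta>} (insert (All F) \<Gamma> \<turnstile> \<Delta>)"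
| AllR: "lkid_rule \<Sigma> \<Phi> {shift 1 ` \<Gamma> \<turnstile> insert F (shift 1 ` \<Delta>)} (\<Gamma> \<turnstile> insert (All F) \<Delta>)"
| ExL: "lkid_rule \<Sigma> \<Phi> {insert F (shift 1 ` \<Gamma>) \<turnstile> shift 1 ` \<Delta>} (insert (Ex F) \<Gamma> \<turnstile> \<Delta>)"
| ExR: "lkid_rule \<Sigma> \<Phi> {\<Gamma> \<turnstile> insert (inst t F) \<Delta>} (\<Gamma> \<turnstile> insert (Ex F) \<Delta>)"
| EqL: "x \<noteq> y \<Longrightarrow> \<sigma> = Var(x := u, y := t) \<Longrightarrow> \<tau> = Var(x := t, y := u) \<Longrightarrow>
    lkid_rule \<Sigma> \<Phi> {subst \<sigma> ` \<Gamma> \<turnstile> subst \<sigma> ` \<Delta>} (insert (Eq t u) (subst \<tau> ` \<Gamma>) \<turnstile> subst \<tau> ` \<Delta>)"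
| EqR: "lkid_rule \<Sigma> \<Phi> {} (\<Gamma> \<turnstile> insert (Eq t t) \<Delta>)"
| ProdR: "r \<in> \<Phi> \<Longrightarrow>
    lkid_rule \<Sigma> \<Phi>
      ((\<lambda>(P, ts). \<Gamma> \<turnstile> insert (Pred P (map (subst_tm \<theta>) ts)) \<Delta>) ` set (ord_prems r @ ind_prems r))
      (\<Gamma> \<turnstile> insert (Pred (concl_pred r) (map (subst_tm \<theta>) (concl_args r))) \<Delta>)"
| Ind: "Pj \<in> dom (ind_ar \<Sigma>) \<Longrightarrow>
    lkid_rule \<Sigma> \<Phi>
      (insert (insert (app 0 (F Pj) us) \<Gamma> \<turnstile> \<Delta>)
        (minor_premise \<Phi> F Pj \<Gamma> \<Delta> ` {r \<in> \<Phi>. mutually_dependent \<Phi> (concl_pred r) Pj}))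
      (insert (Pred Pj us) \<Gamma> \<turnstile> \<Delta>)"

inductive LKID ::
    "('f, 'p) signature \<Rightarrow> ('f, 'p) production set \<Rightarrow> ('f, 'p) sequent \<Rightarrow> bool"
  for \<Sigma> \<Phi> where
  "lkid_rule \<Sigma> \<Phi> S s \<Longrightarrow> wf_sequent \<Sigma> s \<Longrightarrow> (\<And>s'. s' \<in> S \<Longrightarrow> LKID \<Sigma> \<Phi> s') \<Longrightarrow> LKID \<Sigma> \<Phi> s"

end

theory Submission
  imports Defs
begin

text \<open>
  \<open>P\<close> is the reachability relation of a unary function \<open>s\<close>, generated by \<open>P x x\<close> and
  \<open>P x y \<Longrightarrow> P x (s y)\<close>. The larger system adds a predicate \<open>R\<close> that grows its pairs at both ends:
  \<open>R x x\<close>, \<open>R x (s x)\<close>, and \<open>R (s x) y \<Longrightarrow> R x (s y)\<close>. If an ordinary predicate \<open>Q\<close> is closed under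
  the clauses of \<open>R\<close>, then \<open>P x y\<close> implies \<open>Q x y\<close>: induction on \<open>P\<close> gives \<open>R x y\<close>, and
  induction on \<open>R\<close> gives \<open>Q x y\<close>.

  The smaller system does not prove this. Interpret \<open>s\<close> on the integers as \<open>x + 2\<close>, \<open>P\<close> as the total
  relation, and \<open>Q x y\<close> as \<open>x + y \<noteq> 1\<close>. Then \<open>Q\<close> is closed under the clauses of \<open>R\<close> and \<open>Q 0 1\<close>
  fails. The structure amounts to a free action of an infinite group, so a back-and-forth argument
  shows that a formula with parameters cannot tell apart two points far away from the parameters.
  A definable set that contains \<open>x\<close> and is closed under \<open>s\<close> is therefore cofinite, hence everything,
  which is the induction principle for \<open>P\<close>.
\<close>

section \<open>The two systems\<close>

abbreviation suc_tm :: "nat tm \<Rightarrow> nat tm" where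
  "suc_tm t \<equiv> Fun 0 [t]"

abbreviation P :: "nat tm \<Rightarrow> nat tm \<Rightarrow> (nat, nat) fm" where
  "P t u \<equiv> Pred 0 [t, u]"

abbreviation Q :: "nat tm \<Rightarrow> nat tm \<Rightarrow> (nat, nat) fm" where
  "Q t u \<equiv> Pred 1 [t, u]"

abbreviation R :: "nat tm \<Rightarrow> nat tm \<Rightarrow> (nat, nat) fm" where
  "R t u \<equiv> Pred 2 [t, u]"

definition P_refl :: "(nat, nat) production" where
  "P_refl = \<lparr>nvars = 1, ord_prems = [], ind_prems = [],
    concl_pred = 0, concl_args = [Var 0, Var 0]\<rparr>"

definition P_suc :: "(nat, nat) production" where
  "P_suc = \<lparr>nvars = 2, ord_prems = [], ind_prems = [(0, [Var 0, Var 1])],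
    concl_pred = 0, concl_args = [Var 0, suc_tm (Var 1)]\<rparr>"

definition R_refl :: "(nat, nat) production" where
  "R_refl = \<lparr>nvars = 1, ord_prems = [], ind_prems = [],
    concl_pred = 2, concl_args = [Var 0, Var 0]\<rparr>"

definition R_one :: "(nat, nat) production" where
  "R_one = \<lparr>nvars = 1, ord_prems = [], ind_prems = [],
    concl_pred = 2, concl_args = [Var 0, suc_tm (Var 0)]\<rparr>"

definition R_widen :: "(nat, nat) production" where
  "R_widen = \<lparr>nvars = 2, ord_prems = [], ind_prems = [(2, [suc_tm (Var 0), Var 1])],
    concl_pred = 2, concl_args = [Var 0, suc_tm (Var 1)]\<rparr>"

lemmas production_defs = P_refl_def P_suc_def R_refl_def R_one_def R_widen_def

definition sig1 :: "(nat, nat) signature" where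
  "sig1 = \<lparr>fun_ar = [0 \<mapsto> 1], ord_ar = [1 \<mapsto> 2], ind_ar = [0 \<mapsto> 2]\<rparr>"

definition sig2 :: "(nat, nat) signature" where
  "sig2 = \<lparr>fun_ar = [0 \<mapsto> 1], ord_ar = [1 \<mapsto> 2], ind_ar = [0 \<mapsto> 2, 2 \<mapsto> 2]\<rparr>"

definition prods1 :: "(nat, nat) production set" where
  "prods1 = {P_refl, P_suc}"

definition prods2 :: "(nat, nat) production set" where
  "prods2 = {P_refl, P_suc, R_refl, R_one, R_widen}"

text \<open>The three clauses of \<open>R\<close> with \<open>Q\<close> in place of
  \<open>R\<close>. In the last formula index 1 is the outer variable \<open>x\<close> and index 0
  the inner variable \<open>y\<close>.\<close>

definition Q_closed :: "(nat, nat) fm set" where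
  "Q_closed = {All (Q (Var 0) (Var 0)), All (Q (Var 0) (suc_tm (Var 0))),
     All (All (Imp (Q (suc_tm (Var 1)) (Var 0)) (Q (Var 1) (suc_tm (Var 0)))))}"

lemma sig1_sel [simp]:
  "fun_ar sig1 = [0 \<mapsto> 1]" "ord_ar sig1 = [1 \<mapsto> 2]" "ind_ar sig1 = [0 \<mapsto> 2]"
  by (simp_all add: sig1_def)

lemma sig2_sel [simp]:
  "fun_ar sig2 = [0 \<mapsto> 1]" "ord_ar sig2 = [1 \<mapsto> 2]" "ind_ar sig2 = [0 \<mapsto> 2, 2 \<mapsto> 2]"
  by (simp_all add: sig2_def)

lemma system1: "inductive_definition_system sig1 prods1"
  by (auto simp: inductive_definition_system_def prods1_def production_defs
      wf_production_def)

lemma system2: "inductive_definition_system sig2 prods2"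
  by (auto simp: inductive_definition_system_def prods2_def production_defs
      wf_production_def)

lemma sig1_le_sig2: "sig1 \<subseteq>\<^sub>S sig2"
  by (simp add: sig_le_def map_le_def)

lemma wf_P_Q: "wf_sequent sig1 (insert (P (Var 0) (Var 1)) Q_closed \<turnstile> {Q (Var 0) (Var 1)})"
  by (simp add: Q_closed_def)

section \<open>The extension\<close>

lemma wf_tm_mono: "\<Sigma> \<subseteq>\<^sub>S \<Sigma>' \<Longrightarrow> wf_tm \<Sigma> t \<Longrightarrow> wf_tm \<Sigma>' t"
  by (induction t) (auto simp: sig_le_def map_le_def dom_def list_all_iff)

lemma wf_fm_mono: "\<Sigma> \<subseteq>\<^sub>S \<Sigma>' \<Longrightarrow> wf_fm \<Sigma> F \<Longrightarrow> wf_fm \<Sigma>' F"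
  by (induction F)
    (auto intro: wf_tm_mono simp: list_all_iff, auto simp: sig_le_def map_le_def dom_def)

lemma wf_sequent_mono: "\<Sigma> \<subseteq>\<^sub>S \<Sigma>' \<Longrightarrow> wf_sequent \<Sigma> s \<Longrightarrow> wf_sequent \<Sigma>' s"
  by (cases s) (auto intro: wf_fm_mono)

text \<open>The closure of a part of the identity is the identity. In both systems a predicate is a
  premise only of its own productions.\<close>

lemma mutually_dependent_iff_eq:
  assumes "prem_rel \<Phi> \<subseteq> Id"
  shows "mutually_dependent \<Phi> p q \<longleftrightarrow> p = q"
  using rtrancl_mono[OF assms] by (auto simp: mutually_dependent_def)

lemma mutually_dependent_prods1: "mutually_dependent prods1 p q \<longleftrightarrow> p = q"
  by (rule mutually_dependent_iff_eq) (auto simp: prem_rel_def prods1_def production_defs)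

lemma mutually_dependent_prods2: "mutually_dependent prods2 p q \<longleftrightarrow> p = q"
  by (rule mutually_dependent_iff_eq) (auto simp: prem_rel_def prods2_def production_defs)

lemma minor_productions:
  "{r \<in> prods1. mutually_dependent prods1 (concl_pred r) 0} = {P_refl, P_suc}"
  "{r \<in> prods2. mutually_dependent prods2 (concl_pred r) 0} = {P_refl, P_suc}"
  "{r \<in> prods2. mutually_dependent prods2 (concl_pred r) 2} = {R_refl, R_one, R_widen}"
  unfolding mutually_dependent_prods1 mutually_dependent_prods2
  by (auto simp: prods1_def prods2_def production_defs)

text \<open>Only induction could break, since more productions can mean more minor premises. As
  \<open>P\<close> and \<open>R\<close> are not mutually dependent, induction on \<open>P\<close>
  has the same minor premises in both systems.\<close>

lemma lkid_rule_extension: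
  assumes "lkid_rule sig1 prods1 S s"
  shows "lkid_rule sig2 prods2 S s"
  using assms
proof cases
  case (ProdR r \<Gamma> \<theta> \<Delta>)
  moreover have "r \<in> prods2"
    using \<open>r \<in> prods1\<close> by (auto simp: prods1_def prods2_def)
  ultimately show ?thesis
    by (simp only: lkid_rule.ProdR)
next
  case (Ind Pj F us \<Gamma> \<Delta>)
  have Pj: "Pj = 0"
    using Ind(3) by (simp add: split: if_splits)
  have "minor_premise prods1 F 0 = minor_premise prods2 F 0"
    by (simp add: fun_eq_iff minor_premise_def ind_hyp_def mutually_dependent_prods1
        mutually_dependent_prods2)
  moreover have "0 \<in> dom (ind_ar sig2)"
    by simp
  ultimately show ?thesis
    using lkid_rule.Ind[of 0 sig2 prods2 F us \<Gamma> \<Delta>] Ind(1,2) Pj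
    by (simp only: minor_productions)
qed (hypsubst, rule lkid_rule.intros; (assumption | rule refl))+

lemma LKID_extension: "LKID sig1 prods1 s \<Longrightarrow> LKID sig2 prods2 s"
  by (induction rule: LKID.induct)
    (blast intro: LKID.intros lkid_rule_extension wf_sequent_mono[OF sig1_le_sig2])

section \<open>A derivation in the larger system\<close>

abbreviation derivable :: "(nat, nat) sequent \<Rightarrow> bool" where
  "derivable \<equiv> LKID sig2 prods2"

lemma derivable_Axiom:
  "F \<in> \<Gamma> \<Longrightarrow> F \<in> \<Delta> \<Longrightarrow> wf_sequent sig2 (\<Gamma> \<turnstile> \<Delta>) \<Longrightarrow> derivable (\<Gamma> \<turnstile> \<Delta>)"
  by (rule LKID.intros[OF lkid_rule.Axiom]) auto

lemma derivable_Wk: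
  "derivable (\<Gamma>' \<turnstile> \<Delta>') \<Longrightarrow> \<Gamma>' \<subseteq> \<Gamma> \<Longrightarrow> \<Delta>' \<subseteq> \<Delta> \<Longrightarrow> wf_sequent sig2 (\<Gamma> \<turnstile> \<Delta>) \<Longrightarrow> derivable (\<Gamma> \<turnstile> \<Delta>)"
  by (rule LKID.intros[OF lkid_rule.Wk]) auto

lemma derivable_ImpL:
  "derivable (\<Gamma> \<turnstile> insert F \<Delta>) \<Longrightarrow> derivable (insert G \<Gamma> \<turnstile> \<Delta>) \<Longrightarrow>
   wf_sequent sig2 (insert (Imp F G) \<Gamma> \<turnstile> \<Delta>) \<Longrightarrow> derivable (insert (Imp F G) \<Gamma> \<turnstile> \<Delta>)"
  by (rule LKID.intros[OF lkid_rule.ImpL]) auto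

lemma derivable_AllL:
  "derivable (insert (inst t F) \<Gamma> \<turnstile> \<Delta>) \<Longrightarrow> All F \<in> \<Gamma> \<Longrightarrow> wf_sequent sig2 (\<Gamma> \<turnstile> \<Delta>) \<Longrightarrow>
   derivable (\<Gamma> \<turnstile> \<Delta>)"
  using LKID.intros[OF lkid_rule.AllL[of sig2 prods2 t F \<Gamma> \<Delta>]] by (simp add: insert_absorb)

lemma derivable_R_refl:
  assumes "wf_sequent sig2 (\<Gamma> \<turnstile> {R t t})"
  shows "derivable (\<Gamma> \<turnstile> {R t t})"
proof -
  have "R_refl \<in> prods2"
    by (simp add: prods2_def)
  from LKID.intros[OF lkid_rule.ProdR[OF this, of _ \<Gamma> "\<lambda>_. t" "{}"]] assms show ?thesis
    by (simp add: R_refl_def)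
qed

lemma derivable_R_one:
  assumes "wf_sequent sig2 (\<Gamma> \<turnstile> {R t (suc_tm t)})"
  shows "derivable (\<Gamma> \<turnstile> {R t (suc_tm t)})"
proof -
  have "R_one \<in> prods2"
    by (simp add: prods2_def)
  from LKID.intros[OF lkid_rule.ProdR[OF this, of _ \<Gamma> "\<lambda>_. t" "{}"]] assms show ?thesis
    by (simp add: R_one_def)
qed

lemma derivable_R_widen:
  assumes "derivable (\<Gamma> \<turnstile> {R (suc_tm t) u})" "wf_sequent sig2 (\<Gamma> \<turnstile> {R t (suc_tm u)})"
  shows "derivable (\<Gamma> \<turnstile> {R t (suc_tm u)})"
proof -
  have "R_widen \<in> prods2"
    by (simp add: prods2_def)
  from LKID.intros[OF lkid_rule.ProdR[OF this, of _ \<Gamma> "case_nat t (\<lambda>_. u)" "{}"]] assms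
  show ?thesis
    by (simp add: R_widen_def)
qed

lemma derivable_Ind:
  assumes "p \<in> dom (ind_ar sig2)" "derivable (insert (app 0 (F p) us) \<Gamma> \<turnstile> \<Delta>)"
    and "\<And>r. r \<in> {r \<in> prods2. mutually_dependent prods2 (concl_pred r) p} \<Longrightarrow>
      derivable (minor_premise prods2 F p \<Gamma> \<Delta> r)"
    and "wf_sequent sig2 (insert (Pred p us) \<Gamma> \<turnstile> \<Delta>)"
  shows "derivable (insert (Pred p us) \<Gamma> \<turnstile> \<Delta>)"
  by (rule LKID.intros[OF lkid_rule.Ind[OF assms(1), of prods2 F us \<Gamma> \<Delta>] assms(4)])
    (use assms(2,3) in auto)

lemmas minor_premise_simps = minor_premise_def production_defs ind_hyp_def app_def
  mutually_dependent_prods2 nth_Cons'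

text \<open>\<open>R\<close> satisfies the successor clause of \<open>P\<close>, by induction on
  \<open>R\<close>: the case \<open>R x x\<close> is the clause \<open>R x (s x)\<close>, and the
  other two follow by widening \<open>R (s x) (s x)\<close> and the induction hypothesis
  \<open>R (s x) (s y)\<close>.\<close>

lemma derivable_R_suc: "derivable ({R (Var 0) (Var 1)} \<turnstile> {R (Var 0) (suc_tm (Var 1))})"
proof (rule derivable_Ind[where F = "\<lambda>_. R (Var 0) (suc_tm (Var 1))"])
  let ?minor = "minor_premise prods2 (\<lambda>_. R (Var 0) (suc_tm (Var 1))) 2 {}
      {R (Var 0) (suc_tm (Var 1))}"
  have "derivable (?minor R_refl)"
  proof -
    have "derivable ({} \<turnstile> {R (Var 0) (suc_tm (Var 0))})"
      by (rule derivable_R_one) simp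
    then show ?thesis
      unfolding minor_premise_def
      by (rule derivable_Wk) (auto simp: minor_premise_simps shift_def)
  qed
  moreover have "derivable (?minor R_one)"
  proof -
    have "derivable ({} \<turnstile> {R (Var 0) (suc_tm (suc_tm (Var 0)))})"
      by (rule derivable_R_widen, rule derivable_R_refl) simp_all
    then show ?thesis
      unfolding minor_premise_def
      by (rule derivable_Wk) (auto simp: minor_premise_simps shift_def)
  qed
  moreover have "derivable (?minor R_widen)"
  proof -
    have "derivable ({R (suc_tm (Var 0)) (suc_tm (Var 1))} \<turnstile>
        {R (Var 0) (suc_tm (suc_tm (Var 1)))})"
      by (rule derivable_R_widen, rule derivable_Axiom[where F = "R (suc_tm (Var 0)) (suc_tm (Var 1))"])
        simp_all
    then show ?thesis
      unfolding minor_premise_def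
      by (rule derivable_Wk) (auto simp: minor_premise_simps shift_def)
  qed
  ultimately show "derivable (?minor r)"
    if "r \<in> {r \<in> prods2. mutually_dependent prods2 (concl_pred r) 2}" for r
    using that unfolding minor_productions by blast
  show "derivable (insert (app 0 (R (Var 0) (suc_tm (Var 1))) [Var 0, Var 1]) {} \<turnstile>
      {R (Var 0) (suc_tm (Var 1))})"
    unfolding app_def by (rule derivable_Axiom[where F = "R (Var 0) (suc_tm (Var 1))"]) simp_all
qed simp_all

lemma derivable_P_R: "derivable ({P (Var 0) (Var 1)} \<turnstile> {R (Var 0) (Var 1)})"
proof (rule derivable_Ind[where F = "\<lambda>_. R (Var 0) (Var 1)"])
  let ?minor = "minor_premise prods2 (\<lambda>_. R (Var 0) (Var 1)) 0 {} {R (Var 0) (Var 1)}"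
  have "derivable (?minor P_refl)"
  proof -
    have "derivable ({} \<turnstile> {R (Var 0) (Var 0)})"
      by (rule derivable_R_refl) simp
    then show ?thesis
      unfolding minor_premise_def
      by (rule derivable_Wk) (auto simp: minor_premise_simps shift_def)
  qed
  moreover have "derivable (?minor P_suc)"
    unfolding minor_premise_def
    by (rule derivable_Wk[OF derivable_R_suc]) (auto simp: minor_premise_simps shift_def)
  ultimately show "derivable (?minor r)"
    if "r \<in> {r \<in> prods2. mutually_dependent prods2 (concl_pred r) 0}" for r
    using that unfolding minor_productions by blast
  show "derivable (insert (app 0 (R (Var 0) (Var 1)) [Var 0, Var 1]) {} \<turnstile> {R (Var 0) (Var 1)})"
    unfolding app_def by (rule derivable_Axiom[where F = "R (Var 0) (Var 1)"]) simp_all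
qed simp_all

lemma derivable_Q_suc:
  "derivable (insert (Q (suc_tm (Var 0)) (Var 1)) Q_closed \<turnstile> {Q (Var 0) (suc_tm (Var 1))})"
proof -
  let ?prem = "Q (suc_tm (Var 0)) (Var 1)" and ?concl = "Q (Var 0) (suc_tm (Var 1))"
  let ?step = "Imp (Q (suc_tm (Var 1)) (Var 0)) (Q (Var 1) (suc_tm (Var 0)))"
  let ?\<Gamma> = "insert ?prem Q_closed"
  \<comment> \<open>Instantiating the outer variable by \<open>Var 0\<close> leaves the body as it
    is: under the inner quantifier the term becomes \<open>Var 1\<close>, the index it
    replaces.\<close>
  have inst: "inst (Var 0) (All ?step) = All ?step" "inst (Var 1) ?step = Imp ?prem ?concl"
    by (simp_all add: inst_def shift_tm_def)
  have wf: "wf_sequent sig2 (?\<Gamma> \<turnstile> {?concl})"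
    by (simp add: Q_closed_def)
  have "derivable (insert (Imp ?prem ?concl) (insert (All ?step) ?\<Gamma>) \<turnstile> {?concl})"
    by (rule derivable_ImpL; (rule derivable_Axiom[where F = ?prem] derivable_Axiom[where F = ?concl])?)
      (use wf in simp_all)
  then have "derivable (insert (All ?step) ?\<Gamma> \<turnstile> {?concl})"
    by (rule derivable_AllL[where t = "Var 1" and F = ?step, unfolded inst]) (use wf in simp_all)
  then show ?thesis
    by (rule derivable_AllL[where t = "Var 0" and F = "All ?step", unfolded inst])
      (use wf in \<open>simp_all add: Q_closed_def\<close>)
qed

text \<open>The formulas are closed, so they serve unchanged as side formulas of every minor
  premise.\<close>

lemma shift_Q_closed: "shift k ` Q_closed = Q_closed"
  by (simp add: Q_closed_def shift_def shift_tm_def)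

text \<open>Induction on \<open>R\<close> with formula \<open>Q x y\<close>; the members of
  \<open>Q_closed\<close> are what the minor premises ask for.\<close>

lemma derivable_R_Q: "derivable (insert (R (Var 0) (Var 1)) Q_closed \<turnstile> {Q (Var 0) (Var 1)})"
proof (rule derivable_Ind[where F = "\<lambda>_. Q (Var 0) (Var 1)"])
  let ?minor = "minor_premise prods2 (\<lambda>_. Q (Var 0) (Var 1)) 2 Q_closed {Q (Var 0) (Var 1)}"
  have "derivable (?minor R_refl)"
  proof -
    have "derivable (Q_closed \<turnstile> {Q (Var 0) (Var 0)})"
      by (rule derivable_AllL[where t = "Var 0" and F = "Q (Var 0) (Var 0)"])
        (rule derivable_Axiom[where F = "Q (Var 0) (Var 0)"], simp_all add: Q_closed_def inst_def)
    then show ?thesis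
      unfolding minor_premise_def shift_Q_closed
      by (rule derivable_Wk) (auto simp: minor_premise_simps shift_def Q_closed_def)
  qed
  moreover have "derivable (?minor R_one)"
  proof -
    have "derivable (Q_closed \<turnstile> {Q (Var 0) (suc_tm (Var 0))})"
      by (rule derivable_AllL[where t = "Var 0" and F = "Q (Var 0) (suc_tm (Var 0))"])
        (rule derivable_Axiom[where F = "Q (Var 0) (suc_tm (Var 0))"],
          simp_all add: Q_closed_def inst_def)
    then show ?thesis
      unfolding minor_premise_def shift_Q_closed
      by (rule derivable_Wk) (auto simp: minor_premise_simps shift_def Q_closed_def)
  qed
  moreover have "derivable (?minor R_widen)"
    unfolding minor_premise_def shift_Q_closed
    by (rule derivable_Wk[OF derivable_Q_suc])
      (auto simp: minor_premise_simps shift_def Q_closed_def)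
  ultimately show "derivable (?minor r)"
    if "r \<in> {r \<in> prods2. mutually_dependent prods2 (concl_pred r) 2}" for r
    using that unfolding minor_productions by blast
  show "derivable (insert (app 0 (Q (Var 0) (Var 1)) [Var 0, Var 1]) Q_closed \<turnstile> {Q (Var 0) (Var 1)})"
    unfolding app_def by (rule derivable_Axiom[where F = "Q (Var 0) (Var 1)"])
      (simp_all add: Q_closed_def)
qed (simp_all add: Q_closed_def)

lemma derivable_P_Q: "derivable (insert (P (Var 0) (Var 1)) Q_closed \<turnstile> {Q (Var 0) (Var 1)})"
\<comment> \<open>The cut formula lies outside the language of \<open>sig1\<close>.\<close>
proof (rule LKID.intros[OF lkid_rule.Cut[where F = "R (Var 0) (Var 1)"]])
  show wf: "wf_sequent sig2 (insert (P (Var 0) (Var 1)) Q_closed \<turnstile> {Q (Var 0) (Var 1)})"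
    by (rule wf_sequent_mono[OF sig1_le_sig2 wf_P_Q])
  have "derivable (insert (P (Var 0) (Var 1)) Q_closed \<turnstile> {R (Var 0) (Var 1), Q (Var 0) (Var 1)})"
    by (rule derivable_Wk[OF derivable_P_R]) (use wf in auto)
  moreover have "derivable (insert (R (Var 0) (Var 1)) (insert (P (Var 0) (Var 1)) Q_closed) \<turnstile>
      {Q (Var 0) (Var 1)})"
    by (rule derivable_Wk[OF derivable_R_Q]) (use wf in auto)
  ultimately show "derivable s" if "s \<in>
      {insert (P (Var 0) (Var 1)) Q_closed \<turnstile> insert (R (Var 0) (Var 1)) {Q (Var 0) (Var 1)},
       insert (R (Var 0) (Var 1)) (insert (P (Var 0) (Var 1)) Q_closed) \<turnstile> {Q (Var 0) (Var 1)}}"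
    for s
    using that by auto
qed

section \<open>A countermodel to the smaller system\<close>

text \<open>The values at ill-formed terms and atoms are irrelevant.\<close>

primrec val :: "(nat \<Rightarrow> int) \<Rightarrow> 'f tm \<Rightarrow> int" where
  "val v (Var n) = v n"
| "val v (Fun f ts) = hd (map (val v) ts) + 2"

primrec sat :: "(nat \<Rightarrow> int) \<Rightarrow> ('f, nat) fm \<Rightarrow> bool" where
  "sat v (Pred p ts) \<longleftrightarrow> (p = 1 \<longrightarrow> map (val v) ts ! 0 + map (val v) ts ! 1 \<noteq> 1)"
| "sat v (Eq t u) \<longleftrightarrow> val v t = val v u"
| "sat v (Neg F) \<longleftrightarrow> \<not> sat v F"
| "sat v (Conj F G) \<longleftrightarrow> sat v F \<and> sat v G"
| "sat v (Disj F G) \<longleftrightarrow> sat v F \<or> sat v G"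
| "sat v (Imp F G) \<longleftrightarrow> (sat v F \<longrightarrow> sat v G)"
| "sat v (All F) \<longleftrightarrow> (\<forall>a. sat (case_nat a v) F)"
| "sat v (Ex F) \<longleftrightarrow> (\<exists>a. sat (case_nat a v) F)"

fun sat_sequent :: "(nat \<Rightarrow> int) \<Rightarrow> ('f, nat) sequent \<Rightarrow> bool" where
  "sat_sequent v (\<Gamma> \<turnstile> \<Delta>) \<longleftrightarrow> ((\<forall>F \<in> \<Gamma>. sat v F) \<longrightarrow> (\<exists>F \<in> \<Delta>. sat v F))"

definition valid :: "('f, nat) sequent \<Rightarrow> bool" where
  "valid s \<longleftrightarrow> (\<forall>v. sat_sequent v s)"

section \<open>Evaluation of substitutions and instances\<close>

lemma val_subst: "val v (subst_tm \<theta> t) = val (\<lambda>n. val v (\<theta> n)) t"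
  by (induction t) (simp_all add: o_def cong: map_cong)

lemma sat_subst: "sat v (subst \<theta> F) \<longleftrightarrow> sat (\<lambda>n. val v (\<theta> n)) F"
proof (induction F arbitrary: v \<theta>)
  case (Pred p ts)
  have "map (val v) (map (subst_tm \<theta>) ts) = map (val (\<lambda>n. val v (\<theta> n))) ts"
    by (simp add: val_subst)
  then show ?case
    by (simp only: subst.simps sat.simps)
next
  case (All F)
  have "(\<lambda>n. val (case_nat a v) (case_nat (Var 0) (\<lambda>n. shift_tm (\<theta> n)) n)) =
      case_nat a (\<lambda>n. val v (\<theta> n))" for a
    by (auto simp: fun_eq_iff val_subst shift_tm_def split: nat.split)
  then show ?case
    by (simp add: All.IH)
next
  case (Ex F)
  have "(\<lambda>n. val (case_nat a v) (case_nat (Var 0) (\<lambda>n. shift_tm (\<theta> n)) n)) =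
      case_nat a (\<lambda>n. val v (\<theta> n))" for a
    by (auto simp: fun_eq_iff val_subst shift_tm_def split: nat.split)
  then show ?case
    by (simp add: Ex.IH)
qed (simp_all add: val_subst)

lemma sat_shift: "sat v (shift k F) \<longleftrightarrow> sat (\<lambda>n. v (n + k)) F"
  by (simp add: shift_def sat_subst)

lemma sat_inst: "sat v (inst t F) \<longleftrightarrow> sat (case_nat (val v t) v) F"
proof -
  have "(\<lambda>n. val v (case_nat t Var n)) = case_nat (val v t) v"
    by (auto simp: fun_eq_iff split: nat.split)
  then show ?thesis
    by (simp add: inst_def sat_subst)
qed

lemma sat_app2:
  "sat v (app k F [t, u]) \<longleftrightarrow>
     sat (case_nat (val v t) (case_nat (val v u) (\<lambda>n. v (n + k)))) F"
proof -
  have "(\<lambda>n. val v (if n < length [t, u] then [t, u] ! n else Var (n - length [t, u] + k))) =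
      case_nat (val v t) (case_nat (val v u) (\<lambda>n. v (n + k)))"
    by (auto simp: fun_eq_iff split: nat.split)
  then show ?thesis
    by (simp only: app_def sat_subst)
qed

lemma wf_tm_subst_imp: "wf_tm \<Sigma> (subst_tm \<theta> t) \<Longrightarrow> wf_tm \<Sigma> t"
  by (induction t) (auto simp: list_all_iff)

text \<open>The calculus restricts only sequents, so well-formedness of an induction formula is read
  off from its instance in the major premise.\<close>

lemma wf_fm_subst_imp: "wf_fm \<Sigma> (subst \<theta> F) \<Longrightarrow> wf_fm \<Sigma> F"
  by (induction F arbitrary: \<theta>) (auto simp: list_all_iff dest: wf_tm_subst_imp)

section \<open>Agreement of assignments and back-and-forth\<close>

text \<open>
  The successor and \<open>x \<mapsto> 1 - x\<close> generate a group acting freely on the integers, whose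
  elements are \<open>x \<mapsto> x + k\<close> for even \<open>k\<close> and \<open>x \<mapsto> k - x\<close> for odd \<open>k\<close>. Two assignments agree
  if the same such elements with \<open>\<bar>k\<bar> \<le> n\<close> link their values at the variables below \<open>m\<close>.
\<close>

definition agree :: "nat \<Rightarrow> nat \<Rightarrow> (nat \<Rightarrow> int) \<Rightarrow> (nat \<Rightarrow> int) \<Rightarrow> bool" where
  "agree m n v w \<longleftrightarrow> (\<forall>i<m. \<forall>j<m. \<forall>k. \<bar>k\<bar> \<le> int n \<longrightarrow>
     (even k \<longrightarrow> (v i - v j = k \<longleftrightarrow> w i - w j = k)) \<and>
     (odd k \<longrightarrow> (v i + v j = k \<longleftrightarrow> w i + w j = k)))"

definition local_fm :: "nat \<Rightarrow> nat \<Rightarrow> ('f, nat) fm \<Rightarrow> bool" where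
  "local_fm m n F \<longleftrightarrow> (\<forall>v w. agree m n v w \<longrightarrow> (sat v F \<longleftrightarrow> sat w F))"

lemma agree_sym: "agree m n v w \<Longrightarrow> agree m n w v"
  by (simp add: agree_def)

lemma agree_mono:
  assumes "agree m' n' v w" "m \<le> m'" "n \<le> n'"
  shows "agree m n v w"
  unfolding agree_def
proof (intro allI impI)
  fix i j and k :: int
  assume "i < m" "j < m" "\<bar>k\<bar> \<le> int n"
  then have "i < m'" "j < m'" "\<bar>k\<bar> \<le> int n'"
    using assms(2,3) by linarith+
  with assms(1) show "(even k \<longrightarrow> (v i - v j = k \<longleftrightarrow> w i - w j = k)) \<and>
     (odd k \<longrightarrow> (v i + v j = k \<longleftrightarrow> w i + w j = k))"
    unfolding agree_def by blast
qed

lemma local_fm_mono: "local_fm m n F \<Longrightarrow> m \<le> m' \<Longrightarrow> n \<le> n' \<Longrightarrow> local_fm m' n' F"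
  by (meson local_fm_def agree_mono)

lemma agree_diff:
  "agree m n v w \<Longrightarrow> i < m \<Longrightarrow> j < m \<Longrightarrow> \<bar>k\<bar> \<le> int n \<Longrightarrow> even k \<Longrightarrow>
    v i - v j = k \<longleftrightarrow> w i - w j = k"
  by (simp add: agree_def)

lemma agree_add:
  "agree m n v w \<Longrightarrow> i < m \<Longrightarrow> j < m \<Longrightarrow> \<bar>k\<bar> \<le> int n \<Longrightarrow> odd k \<Longrightarrow>
    v i + v j = k \<longleftrightarrow> w i + w j = k"
  by (simp add: agree_def)

text \<open>Some element of the group above with parameter at most \<open>n\<close> in absolute
  value maps \<open>y\<close> to \<open>x\<close>: \<open>x = y + k\<close> with \<open>k\<close>
  even, or \<open>x = k - y\<close> with \<open>k\<close> odd.\<close>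

definition linked :: "nat \<Rightarrow> int \<Rightarrow> int \<Rightarrow> bool" where
  "linked n x y \<longleftrightarrow> (even (x - y) \<and> \<bar>x - y\<bar> \<le> int n) \<or> (odd (x + y) \<and> \<bar>x + y\<bar> \<le> int n)"

text \<open>Pairs of the new value with an old one suffice: the new value against itself gives
  \<open>0 = k\<close> for even \<open>k\<close>, and for odd \<open>k\<close> both sides are false
  because \<open>a + a\<close> and \<open>b + b\<close> are even.\<close>

lemma agree_Cons:
  assumes "agree m n v w"
    and diff: "\<And>j k. j < m \<Longrightarrow> \<bar>k\<bar> \<le> int n \<Longrightarrow> even k \<Longrightarrow> a - v j = k \<longleftrightarrow> b - w j = k"
    and add: "\<And>j k. j < m \<Longrightarrow> \<bar>k\<bar> \<le> int n \<Longrightarrow> odd k \<Longrightarrow> a + v j = k \<longleftrightarrow> b + w j = k"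
  shows "agree (Suc m) n (case_nat a v) (case_nat b w)"
  unfolding agree_def
proof (intro allI impI)
  fix i j k
  assume *: "i < Suc m" "j < Suc m" "\<bar>k\<bar> \<le> int n"
  show "(even k \<longrightarrow> (case_nat a v i - case_nat a v j = k \<longleftrightarrow> case_nat b w i - case_nat b w j = k)) \<and>
     (odd k \<longrightarrow> (case_nat a v i + case_nat a v j = k \<longleftrightarrow> case_nat b w i + case_nat b w j = k))"
  proof (cases i)
    case 0
    then show ?thesis
      using * diff[of "j - 1" k] add[of "j - 1" k] by (cases j) auto
  next
    case (Suc i')
    show ?thesis
    proof (cases j)
      case 0
      then show ?thesis
        using Suc * diff[of i' "- k"] add[of i' k] by (auto simp: add.commute)
    next
      case (Suc j')
      then show ?thesis
        using \<open>i = Suc i'\<close> * assms(1) by (simp add: agree_def)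
    qed
  qed
qed

lemma not_linked_diff: "\<not> linked n x y \<Longrightarrow> \<bar>k\<bar> \<le> int n \<Longrightarrow> even k \<Longrightarrow> x - y \<noteq> k"
  by (auto simp: linked_def)

lemma not_linked_add: "\<not> linked n x y \<Longrightarrow> \<bar>k\<bar> \<le> int n \<Longrightarrow> odd k \<Longrightarrow> x + y \<noteq> k"
  by (auto simp: linked_def)

lemma agree_Cons_unlinked:
  assumes "agree m n v w" "\<And>j. j < m \<Longrightarrow> \<not> linked n a (v j)" "\<And>j. j < m \<Longrightarrow> \<not> linked n b (w j)"
  shows "agree (Suc m) n (case_nat a v) (case_nat b w)"
  using assms(1) by (rule agree_Cons) (use assms(2,3) not_linked_diff not_linked_add in blast)+

lemma bounded_values: "\<exists>B. \<forall>j<m. \<bar>v j\<bar> \<le> (B :: int)" for m :: nat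
  by (rule exI[of _ "\<Sum>j<m. \<bar>v j\<bar>"]) (auto intro: member_le_sum)

text \<open>A value linked to some \<open>v i\<close> is answered by applying the same group element
  to \<open>w i\<close>; composing two elements of size \<open>n\<close> costs radius
  \<open>2 * n\<close>. An unlinked value is answered by one far from all
  \<open>w j\<close>.\<close>

lemma agree_extend:
  assumes agree: "agree m (2 * n) v w"
  obtains b where "agree (Suc m) n (case_nat a v) (case_nat b w)"
proof (cases "\<exists>i<m. linked n a (v i)")
  case True
  have agree': "agree m n v w"
    using agree by (rule agree_mono) auto
  from True obtain i where i: "i < m" "linked n a (v i)"
    by blast
  from i(2) consider "even (a - v i)" "\<bar>a - v i\<bar> \<le> int n" | "odd (a + v i)" "\<bar>a + v i\<bar> \<le> int n"
    unfolding linked_def by blast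
  then show ?thesis
  proof cases
    case 1
    \<comment> \<open>The same translation, by \<open>c = a - v i\<close>: the relation
      \<open>a - v j = k\<close> becomes \<open>v i - v j = k - c\<close>, and sums behave
      likewise.\<close>
    have "agree (Suc m) n (case_nat a v) (case_nat (w i + (a - v i)) w)"
    proof (rule agree_Cons[OF agree'])
      fix j and k :: int
      assume "j < m" "\<bar>k\<bar> \<le> int n" "even k"
      then have "\<bar>k - (a - v i)\<bar> \<le> int (2 * n)" "even (k - (a - v i))"
        using 1 by simp_all
      from agree_diff[OF agree i(1) \<open>j < m\<close> this] show "a - v j = k \<longleftrightarrow> w i + (a - v i) - w j = k"
        by linarith
    next
      fix j and k :: int
      assume "j < m" "\<bar>k\<bar> \<le> int n" "odd k"
      then have "\<bar>k - (a - v i)\<bar> \<le> int (2 * n)" "odd (k - (a - v i))"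
        using 1 by simp_all
      from agree_add[OF agree i(1) \<open>j < m\<close> this] show "a + v j = k \<longleftrightarrow> w i + (a - v i) + w j = k"
        by linarith
    qed
    then show ?thesis
      by (rule that)
  next
    case 2
    \<comment> \<open>The same reflection, with odd sum \<open>c = a + v i\<close>. It swaps
      differences and sums: \<open>a - v j = k\<close> becomes
      \<open>v i + v j = c - k\<close>.\<close>
    have "agree (Suc m) n (case_nat a v) (case_nat (a + v i - w i) w)"
    proof (rule agree_Cons[OF agree'])
      fix j and k :: int
      assume "j < m" "\<bar>k\<bar> \<le> int n" "even k"
      then have "\<bar>a + v i - k\<bar> \<le> int (2 * n)" "odd (a + v i - k)"
        using 2 by simp_all
      from agree_add[OF agree i(1) \<open>j < m\<close> this] show "a - v j = k \<longleftrightarrow> a + v i - w i - w j = k"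
        by linarith
    next
      fix j and k :: int
      assume "j < m" "\<bar>k\<bar> \<le> int n" "odd k"
      then have "\<bar>a + v i - k\<bar> \<le> int (2 * n)" "even (a + v i - k)"
        using 2 by simp_all
      from agree_diff[OF agree i(1) \<open>j < m\<close> this] show "a + v j = k \<longleftrightarrow> a + v i - w i + w j = k"
        by linarith
    qed
    then show ?thesis
      by (rule that)
  qed
next
  case False
  obtain B where B: "\<forall>j<m. \<bar>w j\<bar> \<le> B"
    using bounded_values by blast
  \<comment> \<open>Both the difference from \<open>w j\<close> and the sum with \<open>w j\<close>
    exceed \<open>n\<close>.\<close>
  have "\<not> linked n (\<bar>B\<bar> + int n + 1) (w j)" if "j < m" for j
    using B[rule_format, OF that] unfolding linked_def by linarith
  then show ?thesis
    using agree_mono[OF agree, of m n] False by (intro that agree_Cons_unlinked) auto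
qed

section \<open>Locality of formulas\<close>

text \<open>With a single unary function symbol, a term is an iterated successor of one variable,
  and each successor adds 2.\<close>

lemma val_wf_tm:
  assumes "wf_tm sig1 t"
  obtains i k where "\<And>v. val v t = v i + 2 * k"
proof -
  from assms have "\<exists>i k. \<forall>v. val v t = v i + 2 * k"
  proof (induction t)
    case (Var n)
    then show ?case
      by (intro exI[of _ n] exI[of _ 0]) simp
  next
    case (Fun f ts)
    then have "length ts = 1"
      by (auto split: if_splits)
    then obtain t where ts: "ts = [t]"
      by (auto simp: length_Suc_conv)
    with Fun obtain i k where "\<forall>v. val v t = v i + 2 * k"
      by auto
    with ts show ?case
      by (intro exI[of _ i] exI[of _ "k + 1"]) simp
  qed
  then show ?thesis
    using that by blast
qed

text \<open>The equation says \<open>v i - v j = 2 * l - 2 * k\<close>, an even difference, whose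
  size serves as radius.\<close>

lemma local_fm_Eq:
  assumes "wf_tm sig1 t" "wf_tm sig1 u"
  shows "\<exists>m n. local_fm m n (Eq t u)"
proof -
  obtain i k where t: "\<And>v. val v t = v i + 2 * k"
    using val_wf_tm[OF assms(1)] by blast
  obtain j l where u: "\<And>v. val v u = v j + 2 * l"
    using val_wf_tm[OF assms(2)] by blast
  have "sat v (Eq t u) \<longleftrightarrow> sat w (Eq t u)"
    if "agree (Suc (max i j)) (nat \<bar>2 * l - 2 * k\<bar>) v w" for v w
    using agree_diff[OF that, of i j "2 * l - 2 * k"] by (simp add: t u) linarith
  then show ?thesis
    unfolding local_fm_def by blast
qed

text \<open>\<open>Q\<close> fails exactly when \<open>v i + v j = 1 - 2 * l - 2 * k\<close>, an odd
  sum; the other predicates hold everywhere.\<close>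

lemma local_fm_Pred:
  assumes "wf_fm sig1 (Pred p ts)"
  shows "\<exists>m n. local_fm m n (Pred p ts)"
proof (cases "p = 1")
  case True
  with assms have "length ts = 2"
    by auto
  then obtain t u where ts: "ts = [t, u]"
    by (auto simp: length_Suc_conv numeral_2_eq_2)
  with assms have wf: "wf_tm sig1 t" "wf_tm sig1 u"
    by auto
  obtain i k where t: "\<And>v. val v t = v i + 2 * k"
    using val_wf_tm[OF wf(1)] by blast
  obtain j l where u: "\<And>v. val v u = v j + 2 * l"
    using val_wf_tm[OF wf(2)] by blast
  have "sat v (Pred p ts) \<longleftrightarrow> sat w (Pred p ts)"
    if "agree (Suc (max i j)) (nat \<bar>1 - 2 * l - 2 * k\<bar>) v w" for v w
    using agree_add[OF that, of i j "1 - 2 * l - 2 * k"] by (simp add: t u ts) linarith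
  then show ?thesis
    unfolding local_fm_def by blast
qed (simp add: local_fm_def)

lemma local_fm_join:
  assumes "\<exists>m n. local_fm m n F" "\<exists>m n. local_fm m n G"
  obtains m n where "local_fm m n F" "local_fm m n G"
proof -
  obtain m n m' n' where "local_fm m n F" "local_fm m' n' G"
    using assms by blast
  then have "local_fm (max m m') (max n n') F" "local_fm (max m m') (max n n') G"
    by (auto elim: local_fm_mono)
  then show ?thesis
    by (rule that)
qed

text \<open>By \<open>agree_extend\<close> and symmetry, every value of the bound variable on one
  side has a counterpart on the other that gives \<open>F\<close> the same truth value.\<close>

lemma local_fm_quantifier:
  assumes "local_fm m n F" "agree m (2 * n) v w"
  shows "(\<forall>a. sat (case_nat a v) F) \<longleftrightarrow> (\<forall>a. sat (case_nat a w) F)"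
    and "(\<exists>a. sat (case_nat a v) F) \<longleftrightarrow> (\<exists>a. sat (case_nat a w) F)"
proof -
  have *: "\<exists>b. sat (case_nat a v) F \<longleftrightarrow> sat (case_nat b w) F" if "agree m (2 * n) v w" for a v w
  proof -
    obtain b where "agree (Suc m) n (case_nat a v) (case_nat b w)"
      using agree_extend[OF \<open>agree m (2 * n) v w\<close>] .
    then have "agree m n (case_nat a v) (case_nat b w)"
      by (rule agree_mono) auto
    then show ?thesis
      using assms(1) by (auto simp: local_fm_def)
  qed
  note back_and_forth = *[OF assms(2)] *[OF agree_sym[OF assms(2)]]
  show "(\<forall>a. sat (case_nat a v) F) \<longleftrightarrow> (\<forall>a. sat (case_nat a w) F)"
    using back_and_forth by metis
  show "(\<exists>a. sat (case_nat a v) F) \<longleftrightarrow> (\<exists>a. sat (case_nat a w) F)"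
    using back_and_forth by metis
qed

lemma wf_fm_local: "wf_fm sig1 F \<Longrightarrow> \<exists>m n. local_fm m n F"
proof (induction F)
  case (Pred p ts)
  then show ?case
    by (rule local_fm_Pred)
next
  case (Eq t u)
  then show ?case
    by (simp add: local_fm_Eq)
next
  case (Neg F)
  then show ?case
    by (simp add: local_fm_def)
next
  case (Conj F G)
  then obtain m n where "local_fm m n F" "local_fm m n G"
    using local_fm_join by (metis wf_fm.simps(4))
  then have "local_fm m n (Conj F G)"
    by (simp add: local_fm_def)
  then show ?case
    by blast
next
  case (Disj F G)
  then obtain m n where "local_fm m n F" "local_fm m n G"
    using local_fm_join by (metis wf_fm.simps(5))
  then have "local_fm m n (Disj F G)"
    by (simp add: local_fm_def)
  then show ?case
    by blast
next
  case (Imp F G)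
  then obtain m n where "local_fm m n F" "local_fm m n G"
    using local_fm_join by (metis wf_fm.simps(6))
  then have "local_fm m n (Imp F G)"
    by (simp add: local_fm_def)
  then show ?case
    by blast
next
  case (All F)
  then obtain m n where "local_fm m n F"
    by auto
  then have "local_fm m (2 * n) (All F)"
    by (simp add: local_fm_def local_fm_quantifier(1))
  then show ?case
    by blast
next
  case (Ex F)
  then obtain m n where "local_fm m n F"
    by auto
  then have "local_fm m (2 * n) (Ex F)"
    by (simp add: local_fm_def local_fm_quantifier(2))
  then show ?case
    by blast
qed

section \<open>The induction principle in the countermodel\<close>

lemma agree_upd_unlinked:
  assumes "\<And>j. j < m \<Longrightarrow> \<not> linked n a (v j)" "\<And>j. j < m \<Longrightarrow> \<not> linked n b (v j)"
  shows "agree m n (v(i := a)) (v(i := b))"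
  unfolding agree_def
proof (intro allI impI)
  fix i' j' and k :: int
  assume *: "i' < m" "j' < m" "\<bar>k\<bar> \<le> int n"
  have diff: "even k \<Longrightarrow> a - v j \<noteq> k \<and> a - v j \<noteq> - k \<and> b - v j \<noteq> k \<and> b - v j \<noteq> - k"
    and add: "odd k \<Longrightarrow> a + v j \<noteq> k \<and> b + v j \<noteq> k" if "j < m" for j
    using assms[OF that] * not_linked_diff[of n _ "v j" k] not_linked_diff[of n _ "v j" "- k"]
      not_linked_add[of n _ "v j" k] by simp_all
  show "(even k \<longrightarrow> ((v(i := a)) i' - (v(i := a)) j' = k \<longleftrightarrow> (v(i := b)) i' - (v(i := b)) j' = k)) \<and>
     (odd k \<longrightarrow> ((v(i := a)) i' + (v(i := a)) j' = k \<longleftrightarrow> (v(i := b)) i' + (v(i := b)) j' = k))"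
    using diff[OF *(1)] diff[OF *(2)] add[OF *(1)] add[OF *(2)]
    by (cases "i' = i"; cases "j' = i") (auto simp: add.commute)
qed

text \<open>
  A counterexample \<open>y\<close> yields the counterexamples \<open>y - 2 k\<close>, and such a counterexample
  cannot be told apart from \<open>x + 2 k\<close> if both are far away from all parameters.
\<close>
lemma sat_induction:
  assumes "wf_fm sig1 F"
    and refl: "\<And>x. sat (case_nat x (case_nat x v)) F"
    and suc: "\<And>x y. sat (case_nat x (case_nat y v)) F \<Longrightarrow> sat (case_nat x (case_nat (y + 2) v)) F"
  shows "sat (case_nat x (case_nat y v)) F"
proof (rule ccontr)
  define w where "w = case_nat x (case_nat y v)"
  \<comment> \<open>The clauses of \<open>P\<close> never move the first argument, so it stays fixed
    at \<open>x\<close> and only the set of second arguments matters.\<close>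
  define S where "S z \<longleftrightarrow> sat (w(1 := z)) F" for z
  have "w(1 := z) = case_nat x (case_nat z v)" for z
    by (auto simp: w_def fun_eq_iff split: nat.split)
  then have S: "S z \<longleftrightarrow> sat (case_nat x (case_nat z v)) F" for z
    by (simp only: S_def)
  assume "\<not> sat (case_nat x (case_nat y v)) F"
  then have "\<not> S y"
    by (simp only: S not_False_eq_True)
  have "S x"
    unfolding S by (rule refl)
  have S_suc: "S z \<Longrightarrow> S (z + 2)" for z
    unfolding S by (rule suc)
  have down: "\<not> S (y - 2 * int k)" for k
  proof (induction k)
    case (Suc k)
    then show ?case
      using S_suc[of "y - 2 * int (Suc k)"] by (auto simp: algebra_simps)
  qed (simp add: \<open>\<not> S y\<close>)
  have up: "S (x + 2 * int k)" for k
  proof (induction k)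
    case (Suc k)
    then show ?case
      using S_suc[of "x + 2 * int k"] by (simp add: algebra_simps)
  qed (simp add: \<open>S x\<close>)
  obtain m n where local: "local_fm m n F"
    using wf_fm_local[OF assms(1)] by blast
  obtain B where B: "\<forall>j<m. \<bar>w j\<bar> \<le> B"
    using bounded_values by blast
  \<comment> \<open>Chosen so that \<open>x + 2 * int k\<close> exceeds \<open>B + n\<close> and
    \<open>y - 2 * int k\<close> lies below \<open>- (B + n)\<close>.\<close>
  define k where "k = nat (\<bar>x\<bar> + \<bar>y\<bar> + \<bar>B\<bar> + int n + 1)"
  have "\<not> linked n (x + 2 * int k) (w j)" "\<not> linked n (y - 2 * int k) (w j)" if "j < m" for j
    using B[rule_format, OF that] unfolding linked_def k_def by linarith+
  then have "agree m n (w(1 := x + 2 * int k)) (w(1 := y - 2 * int k))"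
    by (intro agree_upd_unlinked)
  then show False
    using local up[of k] down[of k] by (auto simp: local_fm_def S_def)
qed

section \<open>Soundness of the smaller system\<close>

text \<open>As \<open>P\<close> is total, the induction formula must hold at every pair. At a
  falsifying assignment the minor premises give the closure conditions of
  \<open>sat_induction\<close>, whose conclusion at \<open>us\<close> contradicts the major
  premise.\<close>

lemma valid_Ind:
  assumes wf: "wf_fm sig1 (app 0 (F 0) us)" "length us = 2"
    and major: "valid (insert (app 0 (F 0) us) \<Gamma> \<turnstile> \<Delta>)"
    and minor: "valid (minor_premise prods1 F 0 \<Gamma> \<Delta> P_refl)"
      "valid (minor_premise prods1 F 0 \<Gamma> \<Delta> P_suc)"
  shows "valid (insert (Pred 0 us) \<Gamma> \<turnstile> \<Delta>)"
  unfolding valid_def sat_sequent.simps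
proof (intro allI impI, rule ccontr)
  fix v
  assume "\<forall>G \<in> insert (Pred 0 us) \<Gamma>. sat v G" and not: "\<not> (\<exists>G \<in> \<Delta>. sat v G)"
  then have \<Gamma>: "\<forall>G \<in> \<Gamma>. sat v G"
    by blast
  obtain t u where us: "us = [t, u]"
    using wf(2) by (auto simp: length_Suc_conv numeral_2_eq_2)
  have "sat (case_nat (val v t) (case_nat (val v u) v)) (F 0)"
  proof (rule sat_induction)
    show "wf_fm sig1 (F 0)"
      using wf(1) unfolding app_def by (rule wf_fm_subst_imp)
    show "sat (case_nat x (case_nat x v)) (F 0)" for x
      using minor(1)[unfolded minor_premise_def valid_def sat_sequent.simps, THEN spec, of "case_nat x v"] \<Gamma> not
      by (auto simp: P_refl_def sat_shift sat_app2)
    show "sat (case_nat x (case_nat (y + 2) v)) (F 0)"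
      if "sat (case_nat x (case_nat y v)) (F 0)" for x y
      using minor(2)[unfolded minor_premise_def valid_def sat_sequent.simps, THEN spec,
          of "case_nat x (case_nat y v)"] \<Gamma> not that
      by (auto simp: P_suc_def sat_shift sat_app2 ind_hyp_def mutually_dependent_prods1)
  qed
  moreover have "\<not> sat v (app 0 (F 0) us)"
    using major[unfolded valid_def sat_sequent.simps, THEN spec, of v] \<Gamma> not by auto
  ultimately show False
    by (simp add: us sat_app2)
qed

lemma valid_lkid_rule:
  assumes "lkid_rule sig1 prods1 S s" "wf_sequent sig1 s" "\<And>s'. s' \<in> S \<Longrightarrow> wf_sequent sig1 s'"
    and valid: "\<And>s'. s' \<in> S \<Longrightarrow> valid s'"
  shows "valid s"
  unfolding valid_def
proof
  fix v
  have premise: "sat_sequent w s'" if "s' \<in> S" for w s'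
    using valid[OF that] by (simp add: valid_def)
  have sat_premises: "\<forall>s' \<in> S. sat_sequent v s'"
    using premise by blast
  from assms(1) show "sat_sequent v s"
  proof cases
    case (Subst \<Gamma> \<Delta> \<theta>)
    then show ?thesis
      using premise[of "\<Gamma> \<turnstile> \<Delta>" "\<lambda>n. val v (\<theta> n)"] by (simp add: sat_subst)
  next
    case (AllL t F \<Gamma> \<Delta>)
    then show ?thesis
      using premise[of "insert (inst t F) \<Gamma> \<turnstile> \<Delta>" v] by (auto simp: sat_inst)
  next
    case (AllR \<Gamma> F \<Delta>)
    then have "sat_sequent (case_nat a v) (shift 1 ` \<Gamma> \<turnstile> insert F (shift 1 ` \<Delta>))" for a
      by (intro premise) simp
    then show ?thesis
      by (auto simp: AllR sat_shift)
  next
    case (ExL F \<Gamma> \<Delta>)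
    then have "sat_sequent (case_nat a v) (insert F (shift 1 ` \<Gamma>) \<turnstile> shift 1 ` \<Delta>)" for a
      by (intro premise) simp
    then show ?thesis
      by (auto simp: ExL sat_shift)
  next
    case (ExR \<Gamma> t F \<Delta>)
    then show ?thesis
      using premise[of "\<Gamma> \<turnstile> insert (inst t F) \<Delta>" v] by (auto simp: sat_inst)
  next
    case (EqL x y \<sigma> u t \<tau> \<Gamma> \<Delta>)
    \<comment> \<open>When the equation holds, \<open>t\<close> and \<open>u\<close> have one value,
      so both substitutions evaluate to the same assignment.\<close>
    have "(\<lambda>n. val v (\<sigma> n)) = (\<lambda>n. val v (\<tau> n))" if "val v t = val v u"
      using that EqL(3-5) by auto
    then show ?thesis
      using premise[of "subst \<sigma> ` \<Gamma> \<turnstile> subst \<sigma> ` \<Delta>" v] EqL(1,2) by (auto simp: sat_subst)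
  next
    case (ProdR r \<Gamma> \<theta> \<Delta>)
    \<comment> \<open>Every production concludes with \<open>P\<close>, which is total.\<close>
    then have "concl_pred r = 0"
      by (auto simp: prods1_def P_refl_def P_suc_def)
    then show ?thesis
      using ProdR(2) by simp
  next
    case (Ind Pj F us \<Gamma> \<Delta>)
    have Pj: "Pj = 0"
      using Ind(3) by (simp split: if_splits)
    have S: "S = {insert (app 0 (F 0) us) \<Gamma> \<turnstile> \<Delta>, minor_premise prods1 F 0 \<Gamma> \<Delta> P_refl,
        minor_premise prods1 F 0 \<Gamma> \<Delta> P_suc}"
      using Ind(1) unfolding Pj minor_productions by auto
    have "valid (insert (Pred 0 us) \<Gamma> \<turnstile> \<Delta>)"
    proof (rule valid_Ind)
      show "length us = 2"
        using assms(2) Ind(2) by (auto simp: Pj)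
      show "wf_fm sig1 (app 0 (F 0) us)"
        using assms(3)[of "insert (app 0 (F 0) us) \<Gamma> \<turnstile> \<Delta>"] S by simp
    qed (rule valid, simp add: S)+
    then show ?thesis
      unfolding Ind(2) Pj valid_def by blast
  qed (use sat_premises in auto)
qed

lemma LKID_valid: "LKID sig1 prods1 s \<Longrightarrow> valid s"
proof (induction rule: LKID.induct)
  case (1 S s)
  have "wf_sequent sig1 s'" if "s' \<in> S" for s'
    using 1(3)[OF that] LKID.cases by blast
  with 1 show ?case
    by (blast intro: valid_lkid_rule)
qed

text \<open>The values 0 and 1 have sum 1, so \<open>Q\<close> fails there. \<open>Q_closed\<close>
  holds: \<open>x + x\<close> and \<open>x + x + 2\<close> are even, and both atoms of the third
  clause have the sum \<open>x + y + 2\<close>.\<close>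

lemma not_valid_P_Q: "\<not> valid (insert (P (Var 0) (Var 1)) Q_closed \<turnstile> {Q (Var 0) (Var 1)})"
proof
  let ?v = "case_nat 0 (\<lambda>_. 1) :: nat \<Rightarrow> int"
  assume "valid (insert (P (Var 0) (Var 1)) Q_closed \<turnstile> {Q (Var 0) (Var 1)})"
  moreover have "\<forall>F \<in> insert (P (Var 0) (Var 1)) Q_closed. sat ?v F"
    by (auto simp: Q_closed_def) presburger+
  ultimately have "sat ?v (Q (Var 0) (Var 1))"
    unfolding valid_def sat_sequent.simps by blast
  then show False
    by simp
qed

theorem theorem8p4:
  "\<exists>(\<Sigma>1 :: (nat, nat) signature) \<Phi>1 (\<Sigma>2 :: (nat, nat) signature) \<Phi>2.
     inductive_definition_system \<Sigma>1 \<Phi>1 \<and> inductive_definition_system \<Sigma>2 \<Phi>2 \<and>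
     \<Sigma>1 \<subseteq>\<^sub>S \<Sigma>2 \<and> \<Phi>1 \<subseteq> \<Phi>2 \<and>
     (\<forall>s. LKID \<Sigma>1 \<Phi>1 s \<longrightarrow> LKID \<Sigma>2 \<Phi>2 s) \<and>
     (\<exists>s. wf_sequent \<Sigma>1 s \<and> LKID \<Sigma>2 \<Phi>2 s \<and> \<not> LKID \<Sigma>1 \<Phi>1 s)"
proof (intro exI conjI allI impI)
  show "prods1 \<subseteq> prods2"
    by (auto simp: prods1_def prods2_def)
  show "\<not> LKID sig1 prods1 (insert (P (Var 0) (Var 1)) Q_closed \<turnstile> {Q (Var 0) (Var 1)})"
    using LKID_valid not_valid_P_Q by blast
qed (use system1 system2 sig1_le_sig2 LKID_extension wf_P_Q derivable_P_Q in auto)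

end
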